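(* Let $M=[S;A_M;P_M;B_M]$ be a mathematical system whose underlying recursive system $S=[A_S;P_S;B_S]$ satisfies $A_M=A_S$, $P_M=P_S$, $B_M=B_S$, and let $[M;\mathcal L]$ be the mathematical system with restricted argument lists in $\mathcal L$. Suppose that $\mathcal L$ is enumerable and that the set $\mathcal L_*$ of all lists in $\mathcal L$ without variables is not empty. Let $F$ be a formula of $[M;\mathcal L]$ containing none of the symbols $\exists,\vee,\&,\leftrightarrow$, and suppose $F$ is provable in $[M;\mathcal L]$. Then $\mathrm{Gen}(F)$ is true, i.e. $\top\in V(\mathrm{Gen}(F))$.
   Context: Framework. $X$ is a countably infinite set of variables $\mathbf{x_1},\mathbf{x_2},\dots$. Formulas are written in Polish (prefix) notation. A recursive system $S=[A_S;P_S;B_S]$ consists of a finite alphabet $A_S$ of constant symbols, a finite list $P_S$ of predicate symbols (the same symbol may be used with several arities) and a finite list $B_S$ of basis R-axioms. Lists (argument terms) are strings built from constant symbols and variables; lists without variables are elementary. A prime R-formula is $p\,\lambda_1,\dots,\lambda_i$ ($p\in P_S$, $i\ge0$; $p$ "occurs $i$-ary") or an equation $\sim\lambda,\mu$. An R-formula is a prime R-formula or $\to F\,G$ with $F$ a prime R-formula and $G$ an R-formula; its last prime formula is its R-conclusion. R-axioms are the basis R-axioms and the R-axioms of equality (reflexivity $\sim x,x$ and substitutivity of equals in equations and in each predicate symbol of each arity, e.g. $\to\sim y_1,y_1'\cdots\to\sim y_n,y_n'\;\to p\,y_1,\dots,y_n\;p\,y_1',\dots,y_n'$). An R-derivation in $[S;\mathcal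 L]$ is a finite list of R-formulas, all of whose argument lists lie in $\mathcal L$, each obtained by: (a) writing an R-axiom; (b) from a prime R-formula $F$ and $\to F\,G$ inferring $G$; (c) from $F$ inferring $F\frac{\lambda}{x}$ (replace every occurrence of variable $x$ by $\lambda$) with $\lambda\in\mathcal L$. $\Pi_R(S;\mathcal L)$ is the set of R-formulas occurring in such derivations. A mathematical system $M=[S;A_M;P_M;B_M]$ with restricted argument lists $\mathcal L$, written $[M;\mathcal L]$, has $A_M\supseteq A_S$, $P_M\supseteq P_S$, a set $\mathcal L$ of lists containing every variable and closed under substituting lists of $\mathcal L$ for variables, and basis axioms $B_M\supseteq B_S$. Formulas: prime formulas with arguments in $\mathcal L$, and $\neg F$, $J\,F\,G$ ($J\in\{\to,\leftrightarrow,\&,\vee\}$), $\forall x\,F$, $\exists x\,F$. $F\frac{\lambda}{x}$ replaces free occurrences of $x$ by $\lambda$; $\mathrm{CF}(F;\lambda;x)$ means this substitution is collision-free. Axioms: basis axioms; instances of identically true propositional functions; axioms of equality (the R-axioms of equality); quantifier axioms $\to\forall x F\;F$, $\to\forall x\to F\,G\;\to F\,\forall x\,G$ (if $x\notin\mathrm{free}(F)$), $\leftrightarrow\neg\forall x\neg F\;\exists x F$. Rules: (a) write an axiom; (b) modus ponens: from $F$ and $\to F\,G$ infer $G$; (c) from $F$ infer $F\frac{\lambda}{x}$ if $\lambda\in\mathcal L$ and $\mathrm{CF}(F;\lambda;x)$; (d) from $F$ infer $\forall x F$; (e) induction: for $p\in P_S$, distinct variables $x_1,\dots,x_i$ and a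 formula $G$ such that $x_1,\dots,x_i$ and the variables of $G$ do not occur in $B_S$, let $F'$ ($F\in B_S$) be obtained by replacing every $i$-ary subformula $p\,\lambda_1,\dots,\lambda_i$ by $G\frac{\lambda_1}{x_1}\cdots\frac{\lambda_i}{x_i}$; if $F'$ already occurs in the proof for every $F\in B_S$ whose R-conclusion has $p$ occurring $i$-ary, one may write $\to p\,x_1,\dots,x_i\;G$. A proof is a finite list of formulas each obtained by a rule from earlier ones. Truth. Let $\mathcal F_*$ be the set of formulas without free variables and without $\exists,\vee,\&,\leftrightarrow$. Define $V:\mathcal F_*\to\{\emptyset,\{\top\}\}$: for elementary prime formulas ($\sim\lambda,\mu$ or $p\,\lambda_1,\dots,\lambda_i$ with $\lambda$'s in $\mathcal L_*$), $V=\{\top\}$ iff the formula lies in $\Pi_R(S;\mathcal L)$, else $\emptyset$; $V(\neg F)=\{\top\}\setminus V(F)$; $V(\to F\,G)=(\{\top\}\setminus V(F))\cup V(G)$; $V(\forall x\,F)=\bigcap_{\lambda\in\mathcal L_*}V(F\frac{\lambda}{x})$. If $x_1,\dots,x_m$ are the free variables of $F$ in order of increasing index, $\mathrm{Gen}(F)=\forall x_1\cdots\forall x_m\,F$. *)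

theory Defs
  imports Main "HOL-Library.Countable_Set"
begin

section \<open>Lists and formulas\<close>

text \<open>
  The variables \<open>x\<^sub>1, x\<^sub>2, \<dots>\<close> are represented by their indices. Formulas in Polish notation are
  uniquely readable and are represented by a datatype; constant symbols, variables, predicate
  symbols and logical symbols are thereby automatically kept apart.
\<close>

type_synonym var = nat

datatype 'a symbol = Const 'a | Var var

type_synonym 'a lst = "'a symbol list"

text \<open>
  Lists are nonempty strings (with empty argument strings, \<open>p\<close> with no argument and \<open>p\<close> with
  one empty argument would be the same string).
\<close>

definition lists_over :: "'a set \<Rightarrow> 'a lst set" where
  "lists_over A = {l. l \<noteq> [] \<and> (\<forall>a. Const a \<in> set l \<longrightarrow> a \<in> A)}"

definition lvars :: "'a lst \<Rightarrow> var set" where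
  "lvars l = {x. Var x \<in> set l}"

definition elementary :: "'a lst set \<Rightarrow> 'a lst set" where
  "elementary L = {l \<in> L. lvars l = {}}"

definition lsubst :: "'a lst \<Rightarrow> 'a lst \<Rightarrow> var \<Rightarrow> 'a lst" where
  "lsubst k l x = concat (map (\<lambda>s. if s = Var x then l else [s]) k)"

datatype ('a, 'p) fml =
    Eq "'a lst" "'a lst"
  | Pred 'p "'a lst list"
  | Neg "('a, 'p) fml"
  | Imp "('a, 'p) fml" "('a, 'p) fml"
  | Iff "('a, 'p) fml" "('a, 'p) fml"
  | Conj "('a, 'p) fml" "('a, 'p) fml"
  | Disj "('a, 'p) fml" "('a, 'p) fml"
  | All var "('a, 'p) fml"
  | Ex var "('a, 'p) fml"

primrec formula :: "'p set \<Rightarrow> 'a lst set \<Rightarrow> ('a, 'p) fml \<Rightarrow> bool" where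
  "formula P L (Eq k l) \<longleftrightarrow> k \<in> L \<and> l \<in> L"
| "formula P L (Pred p ls) \<longleftrightarrow> p \<in> P \<and> set ls \<subseteq> L"
| "formula P L (Neg F) \<longleftrightarrow> formula P L F"
| "formula P L (Imp F G) \<longleftrightarrow> formula P L F \<and> formula P L G"
| "formula P L (Iff F G) \<longleftrightarrow> formula P L F \<and> formula P L G"
| "formula P L (Conj F G) \<longleftrightarrow> formula P L F \<and> formula P L G"
| "formula P L (Disj F G) \<longleftrightarrow> formula P L F \<and> formula P L G"
| "formula P L (All x F) \<longleftrightarrow> formula P L F"
| "formula P L (Ex x F) \<longleftrightarrow> formula P L F"

text \<open>All variables, including bound ones and those directly following a quantifier.\<close>

primrec vars :: "('a, 'p) fml \<Rightarrow> var set" where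
  "vars (Eq k l) = lvars k \<union> lvars l"
| "vars (Pred p ls) = (\<Union>l \<in> set ls. lvars l)"
| "vars (Neg F) = vars F"
| "vars (Imp F G) = vars F \<union> vars G"
| "vars (Iff F G) = vars F \<union> vars G"
| "vars (Conj F G) = vars F \<union> vars G"
| "vars (Disj F G) = vars F \<union> vars G"
| "vars (All x F) = insert x (vars F)"
| "vars (Ex x F) = insert x (vars F)"

primrec free :: "('a, 'p) fml \<Rightarrow> var set" where
  "free (Eq k l) = lvars k \<union> lvars l"
| "free (Pred p ls) = (\<Union>l \<in> set ls. lvars l)"
| "free (Neg F) = free F"
| "free (Imp F G) = free F \<union> free G"
| "free (Iff F G) = free F \<union> free G"
| "free (Conj F G) = free F \<union> free G"
| "free (Disj F G) = free F \<union> free G"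
| "free (All x F) = free F - {x}"
| "free (Ex x F) = free F - {x}"

text \<open>
  \<open>fsubst F l x\<close> is \<open>F l/x\<close>, with no renaming of bound variables: absence of collisions is the
  separate condition \<open>CF F l x\<close>.
\<close>

primrec fsubst :: "('a, 'p) fml \<Rightarrow> 'a lst \<Rightarrow> var \<Rightarrow> ('a, 'p) fml" where
  "fsubst (Eq j k) l x = Eq (lsubst j l x) (lsubst k l x)"
| "fsubst (Pred p ks) l x = Pred p (map (\<lambda>k. lsubst k l x) ks)"
| "fsubst (Neg F) l x = Neg (fsubst F l x)"
| "fsubst (Imp F G) l x = Imp (fsubst F l x) (fsubst G l x)"
| "fsubst (Iff F G) l x = Iff (fsubst F l x) (fsubst G l x)"
| "fsubst (Conj F G) l x = Conj (fsubst F l x) (fsubst G l x)"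
| "fsubst (Disj F G) l x = Disj (fsubst F l x) (fsubst G l x)"
| "fsubst (All y F) l x = All y (if y = x then F else fsubst F l x)"
| "fsubst (Ex y F) l x = Ex y (if y = x then F else fsubst F l x)"

primrec CF :: "('a, 'p) fml \<Rightarrow> 'a lst \<Rightarrow> var \<Rightarrow> bool" where
  "CF (Eq j k) l x \<longleftrightarrow> True"
| "CF (Pred p ks) l x \<longleftrightarrow> True"
| "CF (Neg F) l x \<longleftrightarrow> CF F l x"
| "CF (Imp F G) l x \<longleftrightarrow> CF F l x \<and> CF G l x"
| "CF (Iff F G) l x \<longleftrightarrow> CF F l x \<and> CF G l x"
| "CF (Conj F G) l x \<longleftrightarrow> CF F l x \<and> CF G l x"
| "CF (Disj F G) l x \<longleftrightarrow> CF F l x \<and> CF G l x"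
| "CF (All y F) l x \<longleftrightarrow> x \<notin> free (All y F) \<or> y \<notin> lvars l \<and> CF F l x"
| "CF (Ex y F) l x \<longleftrightarrow> x \<notin> free (Ex y F) \<or> y \<notin> lvars l \<and> CF F l x"

section \<open>Recursive systems and R-derivations\<close>

record ('a, 'p) recsys =
  A_S :: "'a set"
  P_S :: "'p set"
  B_S :: "('a, 'p) fml set"

primrec prime_fml :: "('a, 'p) fml \<Rightarrow> bool" where
  "prime_fml (Eq k l) \<longleftrightarrow> True"
| "prime_fml (Pred p ls) \<longleftrightarrow> True"
| "prime_fml (Neg F) \<longleftrightarrow> False"
| "prime_fml (Imp F G) \<longleftrightarrow> False"
| "prime_fml (Iff F G) \<longleftrightarrow> False"
| "prime_fml (Conj F G) \<longleftrightarrow> False"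
| "prime_fml (Disj F G) \<longleftrightarrow> False"
| "prime_fml (All x F) \<longleftrightarrow> False"
| "prime_fml (Ex x F) \<longleftrightarrow> False"

inductive is_rformula :: "('a, 'p) fml \<Rightarrow> bool" where
  prime: "prime_fml F \<Longrightarrow> is_rformula F"
| imp: "prime_fml F \<Longrightarrow> is_rformula G \<Longrightarrow> is_rformula (Imp F G)"

fun rconclusion :: "('a, 'p) fml \<Rightarrow> ('a, 'p) fml" where
  "rconclusion (Imp F G) = rconclusion G"
| "rconclusion F = F"

definition recursive_system :: "('a, 'p) recsys \<Rightarrow> bool" where
  "recursive_system S \<longleftrightarrow>
     finite (A_S S) \<and> finite (P_S S) \<and> finite (B_S S) \<and>
     (\<forall>F \<in> B_S S. is_rformula F \<and> formula (P_S S) (lists_over (A_S S)) F)"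

text \<open>
  Substitutivity in equations acts on variables inside arbitrary argument lists: otherwise
  \<open>\<sim>a,b\<close> would not yield \<open>\<sim>aa,bb\<close>, and equality would not be compatible with
  the formulas \<open>G\<close> admitted in the induction rule below. The variables in the third rule need not
  be distinct.
\<close>

inductive equality_axiom :: "'p set \<Rightarrow> 'a lst set \<Rightarrow> ('a, 'p) fml \<Rightarrow> bool" for P L where
  refl: "equality_axiom P L (Eq [Var x] [Var x])"
| eq: "k \<in> L \<Longrightarrow> l \<in> L \<Longrightarrow>
    equality_axiom P L
      (Imp (Eq [Var x] [Var y]) (Imp (Eq k l) (Eq (lsubst k [Var y] x) (lsubst l [Var y] x))))"
| pred: "p \<in> P \<Longrightarrow> length ys = length zs \<Longrightarrow>
    equality_axiom P L
      (foldr Imp (map2 (\<lambda>y z. Eq [Var y] [Var z]) ys zs)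
        (Imp (Pred p (map (\<lambda>y. [Var y]) ys)) (Pred p (map (\<lambda>z. [Var z]) zs))))"

inductive rderivation :: "('a, 'p) recsys \<Rightarrow> 'a lst set \<Rightarrow> ('a, 'p) fml list \<Rightarrow> bool" for S L where
  Nil: "rderivation S L []"
| basis: "rderivation S L Fs \<Longrightarrow> F \<in> B_S S \<Longrightarrow> formula (P_S S) L F \<Longrightarrow> rderivation S L (Fs @ [F])"
| equality: "rderivation S L Fs \<Longrightarrow> equality_axiom (P_S S) L F \<Longrightarrow> rderivation S L (Fs @ [F])"
| mp: "rderivation S L Fs \<Longrightarrow> prime_fml F \<Longrightarrow> F \<in> set Fs \<Longrightarrow> Imp F G \<in> set Fs \<Longrightarrow>
    rderivation S L (Fs @ [G])"
| subst: "rderivation S L Fs \<Longrightarrow> F \<in> set Fs \<Longrightarrow> l \<in> L \<Longrightarrow> rderivation S L (Fs @ [fsubst F l x])"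

definition Pi_R :: "('a, 'p) recsys \<Rightarrow> 'a lst set \<Rightarrow> ('a, 'p) fml set" where
  "Pi_R S L = {F. \<exists>Fs. rderivation S L Fs \<and> F \<in> set Fs}"

section \<open>Mathematical systems with restricted argument lists\<close>

record ('a, 'p) mathsys =
  rec_of :: "('a, 'p) recsys"
  A_M :: "'a set"
  P_M :: "'p set"
  B_M :: "('a, 'p) fml set"

text \<open>The last conjunct says that the basis axioms are formulas of \<open>[M; L]\<close>.\<close>

definition restricted_system :: "('a, 'p) mathsys \<Rightarrow> 'a lst set \<Rightarrow> bool" where
  "restricted_system M L \<longleftrightarrow>
     recursive_system (rec_of M) \<and>
     A_S (rec_of M) \<subseteq> A_M M \<and> P_S (rec_of M) \<subseteq> P_M M \<and> B_S (rec_of M) \<subseteq> B_M M \<and>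
     L \<subseteq> lists_over (A_M M) \<and>
     (\<forall>x. [Var x] \<in> L) \<and>
     (\<forall>k \<in> L. \<forall>l \<in> L. \<forall>x. lsubst k l x \<in> L) \<and>
     (\<forall>F \<in> B_M M. formula (P_M M) L F)"

datatype propfn =
    PVar nat
  | PNeg propfn
  | PImp propfn propfn
  | PIff propfn propfn
  | PConj propfn propfn
  | PDisj propfn propfn

primrec peval :: "(nat \<Rightarrow> bool) \<Rightarrow> propfn \<Rightarrow> bool" where
  "peval v (PVar n) \<longleftrightarrow> v n"
| "peval v (PNeg f) \<longleftrightarrow> \<not> peval v f"
| "peval v (PImp f g) \<longleftrightarrow> (peval v f \<longrightarrow> peval v g)"
| "peval v (PIff f g) \<longleftrightarrow> (peval v f \<longleftrightarrow> peval v g)"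
| "peval v (PConj f g) \<longleftrightarrow> peval v f \<and> peval v g"
| "peval v (PDisj f g) \<longleftrightarrow> peval v f \<or> peval v g"

primrec pinst :: "(nat \<Rightarrow> ('a, 'p) fml) \<Rightarrow> propfn \<Rightarrow> ('a, 'p) fml" where
  "pinst \<phi> (PVar n) = \<phi> n"
| "pinst \<phi> (PNeg f) = Neg (pinst \<phi> f)"
| "pinst \<phi> (PImp f g) = Imp (pinst \<phi> f) (pinst \<phi> g)"
| "pinst \<phi> (PIff f g) = Iff (pinst \<phi> f) (pinst \<phi> g)"
| "pinst \<phi> (PConj f g) = Conj (pinst \<phi> f) (pinst \<phi> g)"
| "pinst \<phi> (PDisj f g) = Disj (pinst \<phi> f) (pinst \<phi> g)"

inductive quantifier_axiom :: "('a, 'p) fml \<Rightarrow> bool" where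
  "quantifier_axiom (Imp (All x F) F)"
| "x \<notin> free F \<Longrightarrow> quantifier_axiom (Imp (All x (Imp F G)) (Imp F (All x G)))"
| "quantifier_axiom (Iff (Neg (All x (Neg F))) (Ex x F))"

inductive is_axiom :: "('a, 'p) mathsys \<Rightarrow> 'a lst set \<Rightarrow> ('a, 'p) fml \<Rightarrow> bool" for M L where
  basis: "F \<in> B_M M \<Longrightarrow> is_axiom M L F"
| propositional: "(\<And>v. peval v f) \<Longrightarrow> formula (P_M M) L (pinst \<phi> f) \<Longrightarrow> is_axiom M L (pinst \<phi> f)"
| equality: "equality_axiom (P_M M) L F \<Longrightarrow> is_axiom M L F"
| quantifier: "quantifier_axiom F \<Longrightarrow> formula (P_M M) L F \<Longrightarrow> is_axiom M L F"

text \<open>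
  \<open>ind_replace p [x\<^sub>1, \<dots>, x\<^sub>i] G F\<close> is the formula \<open>F'\<close> of the induction rule: each \<open>i\<close>-ary
  subformula \<open>p l\<^sub>1, \<dots>, l\<^sub>i\<close> of \<open>F\<close> becomes \<open>G l\<^sub>1/x\<^sub>1 \<dots> l\<^sub>i/x\<^sub>i\<close>, substituted from left to right.
\<close>

primrec ind_replace :: "'p \<Rightarrow> var list \<Rightarrow> ('a, 'p) fml \<Rightarrow> ('a, 'p) fml \<Rightarrow> ('a, 'p) fml" where
  "ind_replace p xs G (Eq k l) = Eq k l"
| "ind_replace p xs G (Pred q ls) =
     (if q = p \<and> length ls = length xs
      then foldl (\<lambda>H (x, l). fsubst H l x) G (zip xs ls)
      else Pred q ls)"
| "ind_replace p xs G (Neg F) = Neg (ind_replace p xs G F)"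
| "ind_replace p xs G (Imp F F') = Imp (ind_replace p xs G F) (ind_replace p xs G F')"
| "ind_replace p xs G (Iff F F') = Iff (ind_replace p xs G F) (ind_replace p xs G F')"
| "ind_replace p xs G (Conj F F') = Conj (ind_replace p xs G F) (ind_replace p xs G F')"
| "ind_replace p xs G (Disj F F') = Disj (ind_replace p xs G F) (ind_replace p xs G F')"
| "ind_replace p xs G (All x F) = All x (ind_replace p xs G F)"
| "ind_replace p xs G (Ex x F) = Ex x (ind_replace p xs G F)"

inductive is_proof :: "('a, 'p) mathsys \<Rightarrow> 'a lst set \<Rightarrow> ('a, 'p) fml list \<Rightarrow> bool" for M L where
  Nil: "is_proof M L []"
| axiom: "is_proof M L Fs \<Longrightarrow> is_axiom M L F \<Longrightarrow> is_proof M L (Fs @ [F])"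
| mp: "is_proof M L Fs \<Longrightarrow> F \<in> set Fs \<Longrightarrow> Imp F G \<in> set Fs \<Longrightarrow> is_proof M L (Fs @ [G])"
| subst: "is_proof M L Fs \<Longrightarrow> F \<in> set Fs \<Longrightarrow> l \<in> L \<Longrightarrow> CF F l x \<Longrightarrow>
    is_proof M L (Fs @ [fsubst F l x])"
| generalize: "is_proof M L Fs \<Longrightarrow> F \<in> set Fs \<Longrightarrow> is_proof M L (Fs @ [All x F])"
| induction: "is_proof M L Fs \<Longrightarrow> p \<in> P_S (rec_of M) \<Longrightarrow> distinct xs \<Longrightarrow> formula (P_M M) L G \<Longrightarrow>
    (\<And>F. F \<in> B_S (rec_of M) \<Longrightarrow> (set xs \<union> vars G) \<inter> vars F = {}) \<Longrightarrow>
    (\<And>F ls. F \<in> B_S (rec_of M) \<Longrightarrow> rconclusion F = Pred p ls \<Longrightarrow> length ls = length xs \<Longrightarrow>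
       ind_replace p xs G F \<in> set Fs) \<Longrightarrow>
    is_proof M L (Fs @ [Imp (Pred p (map (\<lambda>x. [Var x]) xs)) G])"

definition provable :: "('a, 'p) mathsys \<Rightarrow> 'a lst set \<Rightarrow> ('a, 'p) fml \<Rightarrow> bool" where
  "provable M L F \<longleftrightarrow> (\<exists>Fs. is_proof M L Fs \<and> F \<in> set Fs)"

section \<open>Truth\<close>

text \<open>No occurrence of \<open>\<exists>\<close>, \<open>\<or>\<close>, \<open>&\<close>, \<open>\<leftrightarrow>\<close>.\<close>

primrec basic_fml :: "('a, 'p) fml \<Rightarrow> bool" where
  "basic_fml (Eq k l) \<longleftrightarrow> True"
| "basic_fml (Pred p ls) \<longleftrightarrow> True"
| "basic_fml (Neg F) \<longleftrightarrow> basic_fml F"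
| "basic_fml (Imp F G) \<longleftrightarrow> basic_fml F \<and> basic_fml G"
| "basic_fml (Iff F G) \<longleftrightarrow> False"
| "basic_fml (Conj F G) \<longleftrightarrow> False"
| "basic_fml (Disj F G) \<longleftrightarrow> False"
| "basic_fml (All x F) \<longleftrightarrow> basic_fml F"
| "basic_fml (Ex x F) \<longleftrightarrow> False"

datatype verum = Top

primrec depth :: "('a, 'p) fml \<Rightarrow> nat" where
  "depth (Eq k l) = 0"
| "depth (Pred p ls) = 0"
| "depth (Neg F) = Suc (depth F)"
| "depth (Imp F G) = Suc (depth F + depth G)"
| "depth (Iff F G) = Suc (depth F + depth G)"
| "depth (Conj F G) = Suc (depth F + depth G)"
| "depth (Disj F G) = Suc (depth F + depth G)"
| "depth (All x F) = Suc (depth F)"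
| "depth (Ex x F) = Suc (depth F)"

lemma depth_fsubst [simp]: "depth (fsubst F l x) = depth F"
  by (induction F) auto

text \<open>
  The intended domain of \<open>V S L\<close> consists of the closed formulas of \<open>[M; L]\<close> satisfying
  \<open>basic_fml\<close>; the values elsewhere are irrelevant.
\<close>

function V :: "('a, 'p) recsys \<Rightarrow> 'a lst set \<Rightarrow> ('a, 'p) fml \<Rightarrow> verum set" where
  "V S L (Eq k l) = (if Eq k l \<in> Pi_R S L then {Top} else {})"
| "V S L (Pred p ls) = (if Pred p ls \<in> Pi_R S L then {Top} else {})"
| "V S L (Neg F) = {Top} - V S L F"
| "V S L (Imp F G) = ({Top} - V S L F) \<union> V S L G"
| "V S L (All x F) = (\<Inter>l \<in> elementary L. V S L (fsubst F l x))"
| "V S L (Iff F G) = undefined"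
| "V S L (Conj F G) = undefined"
| "V S L (Disj F G) = undefined"
| "V S L (Ex x F) = undefined"
  by pat_completeness auto
termination
  by (relation "measure (\<lambda>(S, L, F). depth F)") auto

definition Gen :: "('a, 'p) fml \<Rightarrow> ('a, 'p) fml" where
  "Gen F = foldr All (sorted_list_of_set (free F)) F"

end

theory Submission
  imports Defs
begin

text \<open>
  Truth is rephrased by a Tarskian satisfaction relation in which variables range over
  \<open>elementary L\<close> and closed prime formulas hold iff they are R-derivable; provable formulas hold
  under every valuation. The delicate rule is induction. Closed R-derivable formulas form the
  least relations closed under the basis axioms and the equality axioms, so for a valuation
  \<open>\<rho>\<close> one reinterprets the \<open>i\<close>-ary \<open>p\<close> as the set of those R-derivable tuples that
  satisfy \<open>G\<close> under \<open>\<rho>\<close>, and checks that all R-derivable formulas remain valid. For basis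
  axioms this is the hypothesis of the rule; for the equality axioms it says that satisfaction of
  \<open>G\<close> is invariant under R-derivable equality of the values of the variables.
\<close>

section \<open>Satisfaction\<close>

primrec sapp :: "(var \<Rightarrow> 'a lst) \<Rightarrow> 'a symbol \<Rightarrow> 'a lst" where
  "sapp \<sigma> (Const a) = [Const a]"
| "sapp \<sigma> (Var x) = \<sigma> x"

text \<open>The map \<open>\<sigma>\<close> serves both as a valuation, when its values are
  elementary, and as a simultaneous substitution; \<open>lsubst\<close> is the instance that moves a
  single variable.\<close>

definition lapp :: "(var \<Rightarrow> 'a lst) \<Rightarrow> 'a lst \<Rightarrow> 'a lst" where
  "lapp \<sigma> l = concat (map (sapp \<sigma>) l)"

lemma lapp_simps [simp]:
  "lapp \<sigma> [] = []"
  "lapp \<sigma> (s # l) = sapp \<sigma> s @ lapp \<sigma> l"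
  by (simp_all add: lapp_def)

lemma lapp_append [simp]: "lapp \<sigma> (k @ l) = lapp \<sigma> k @ lapp \<sigma> l"
  by (simp add: lapp_def)

lemma lsubst_simps [simp]:
  "lsubst [] l x = []"
  "lsubst (s # k) l x = (if s = Var x then l else [s]) @ lsubst k l x"
  by (simp_all add: lsubst_def)

lemma lvars_simps [simp]:
  "lvars [] = {}"
  "lvars (Const a # l) = lvars l"
  "lvars (Var x # l) = insert x (lvars l)"
  by (auto simp: lvars_def)

lemma lvars_append [simp]: "lvars (k @ l) = lvars k \<union> lvars l"
  by (auto simp: lvars_def)

lemma finite_lvars [simp]: "finite (lvars l)"
proof (induction l)
  case (Cons s l)
  then show ?case by (cases s) auto
qed simp

lemma lapp_cong:
  assumes "\<And>x. x \<in> lvars l \<Longrightarrow> \<sigma> x = \<tau> x"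
  shows "lapp \<sigma> l = lapp \<tau> l"
  using assms
proof (induction l)
  case (Cons s l)
  then show ?case by (cases s) auto
qed simp

lemma lapp_Var [simp]: "lapp (\<lambda>x. [Var x]) l = l"
proof (induction l)
  case (Cons s l)
  then show ?case by (cases s) auto
qed simp

lemma lapp_closed [simp]: "lvars l = {} \<Longrightarrow> lapp \<sigma> l = l"
  using lapp_cong[of l \<sigma> "\<lambda>x. [Var x]"] by simp

lemma lapp_lsubst: "lapp \<sigma> (lsubst k l x) = lapp (\<sigma>(x := lapp \<sigma> l)) k"
proof (induction k)
  case (Cons s k)
  then show ?case by (cases s) auto
qed simp

lemma lapp_lapp: "lapp \<sigma> (lapp \<tau> l) = lapp (\<lambda>x. lapp \<sigma> (\<tau> x)) l"
proof (induction l)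
  case (Cons s l)
  then show ?case by (cases s) auto
qed simp

lemma lsubst_eq_lapp: "lsubst k l x = lapp ((\<lambda>y. [Var y])(x := l)) k"
  using lapp_lsubst[of "\<lambda>y. [Var y]" k l x] by simp

lemma lvars_lapp: "lvars (lapp \<sigma> l) = (\<Union>x\<in>lvars l. lvars (\<sigma> x))"
proof (induction l)
  case (Cons s l)
  then show ?case by (cases s) auto
qed simp

lemma lvars_lsubst: "lvars (lsubst k l x) = lvars k - {x} \<union> (if x \<in> lvars k then lvars l else {})"
  by (auto simp: lsubst_eq_lapp lvars_lapp split: if_splits)

lemma lsubst_idle: "x \<notin> lvars k \<Longrightarrow> lsubst k l x = k"
  unfolding lsubst_eq_lapp by (rule trans[OF lapp_cong lapp_Var]) auto

section \<open>Free variables, bound variables and collisions\<close>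

lemma finite_free [simp]: "finite (free F)"
  by (induction F) auto

lemma free_subset_vars: "free F \<subseteq> vars F"
  by (induction F) auto

lemma fsubst_idle: "x \<notin> free F \<Longrightarrow> fsubst F l x = F"
  by (induction F) (auto simp: lsubst_idle intro!: map_idI)

lemma free_fsubst_closed: "lvars l = {} \<Longrightarrow> free (fsubst F l x) = free F - {x}"
  by (induction F) (auto simp: lvars_lsubst split: if_splits)

lemma basic_fml_fsubst: "basic_fml (fsubst F l x) = basic_fml F"
  by (induction F) auto

lemma CF_closed: "lvars l = {} \<Longrightarrow> CF F l x"
  by (induction F) auto

text \<open>Disjointness from \<open>bvars\<close> is a crude sufficient condition for
  \<open>CF\<close>. Since \<open>bvars\<close> is unchanged by \<open>fsubst\<close>, it survives
  the iterated substitutions of the induction rule.\<close>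

primrec bvars :: "('a, 'p) fml \<Rightarrow> var set" where
  "bvars (Eq k l) = {}"
| "bvars (Pred p ls) = {}"
| "bvars (Neg F) = bvars F"
| "bvars (Imp F G) = bvars F \<union> bvars G"
| "bvars (Iff F G) = bvars F \<union> bvars G"
| "bvars (Conj F G) = bvars F \<union> bvars G"
| "bvars (Disj F G) = bvars F \<union> bvars G"
| "bvars (All x F) = insert x (bvars F)"
| "bvars (Ex x F) = insert x (bvars F)"

lemma bvars_subset_vars: "bvars F \<subseteq> vars F"
  by (induction F) auto

lemma bvars_fsubst [simp]: "bvars (fsubst F l x) = bvars F"
  by (induction F) auto

lemma CF_if_bvars_disjoint: "bvars F \<inter> lvars l = {} \<Longrightarrow> CF F l x"
  by (induction F) auto

text \<open>The parameter \<open>I\<close> interprets closed prime formulas, so that one relation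
  serves both R-derivability and the reinterpretation of \<open>p\<close>. Unlike \<open>V\<close>
  it gives every connective its meaning, since a proof of a basic formula may pass through formulas
  that are not basic.\<close>

primrec sat ::
  "(('a, 'p) fml \<Rightarrow> bool) \<Rightarrow> 'a lst set \<Rightarrow> (var \<Rightarrow> 'a lst) \<Rightarrow> ('a, 'p) fml \<Rightarrow> bool" where
  "sat I D \<sigma> (Eq k l) \<longleftrightarrow> I (Eq (lapp \<sigma> k) (lapp \<sigma> l))"
| "sat I D \<sigma> (Pred p ls) \<longleftrightarrow> I (Pred p (map (lapp \<sigma>) ls))"
| "sat I D \<sigma> (Neg F) \<longleftrightarrow> \<not> sat I D \<sigma> F"
| "sat I D \<sigma> (Imp F G) \<longleftrightarrow> (sat I D \<sigma> F \<longrightarrow> sat I D \<sigma> G)"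
| "sat I D \<sigma> (Iff F G) \<longleftrightarrow> (sat I D \<sigma> F \<longleftrightarrow> sat I D \<sigma> G)"
| "sat I D \<sigma> (Conj F G) \<longleftrightarrow> sat I D \<sigma> F \<and> sat I D \<sigma> G"
| "sat I D \<sigma> (Disj F G) \<longleftrightarrow> sat I D \<sigma> F \<or> sat I D \<sigma> G"
| "sat I D \<sigma> (All x F) \<longleftrightarrow> (\<forall>d \<in> D. sat I D (\<sigma>(x := d)) F)"
| "sat I D \<sigma> (Ex x F) \<longleftrightarrow> (\<exists>d \<in> D. sat I D (\<sigma>(x := d)) F)"

lemma sat_cong:
  assumes "\<And>x. x \<in> free F \<Longrightarrow> \<sigma> x = \<tau> x"
  shows "sat I D \<sigma> F \<longleftrightarrow> sat I D \<tau> F"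
  using assms
proof (induction F arbitrary: \<sigma> \<tau>)
  case (Eq k l)
  then have "lapp \<sigma> k = lapp \<tau> k" "lapp \<sigma> l = lapp \<tau> l" by (auto intro: lapp_cong)
  then show ?case by simp
next
  case (Pred p ls)
  then have "map (lapp \<sigma>) ls = map (lapp \<tau>) ls" by (auto intro!: lapp_cong)
  then show ?case by (simp del: map_eq_conv)
next
  case (Neg F)
  from Neg.IH[of \<sigma> \<tau>] Neg.prems show ?case by simp
next
  case (Imp F G)
  from Imp.IH[of \<sigma> \<tau>] Imp.prems show ?case by simp
next
  case (Iff F G)
  from Iff.IH[of \<sigma> \<tau>] Iff.prems show ?case by simp
next
  case (Conj F G)
  from Conj.IH[of \<sigma> \<tau>] Conj.prems show ?case by simp
next
  case (Disj F G)
  from Disj.IH[of \<sigma> \<tau>] Disj.prems show ?case by simp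
next
  case (All x F)
  have "sat I D (\<sigma>(x := d)) F = sat I D (\<tau>(x := d)) F" for d
    by (rule All.IH) (use All.prems in auto)
  then show ?case by simp
next
  case (Ex x F)
  have "sat I D (\<sigma>(x := d)) F = sat I D (\<tau>(x := d)) F" for d
    by (rule Ex.IH) (use Ex.prems in auto)
  then show ?case by simp
qed

lemma sat_upd_idle: "x \<notin> free F \<Longrightarrow> sat I D (\<sigma>(x := d)) F \<longleftrightarrow> sat I D \<sigma> F"
  by (rule sat_cong) auto

text \<open>Shared by both quantifiers; the second assumption is their induction hypothesis. If
  \<open>x\<close> is free below the quantifier, then \<open>y\<close> is not in \<open>l\<close>,
  so the value of \<open>l\<close> ignores the update at \<open>y\<close> and the two updates
  commute. Otherwise nothing is substituted and the valuations agree on the free variables.\<close>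

lemma sat_fsubst_under_quantifier:
  assumes "x \<notin> free F - {y} \<or> y \<notin> lvars l \<and> CF F l x"
    and "\<And>\<sigma>. CF F l x \<Longrightarrow> sat I D \<sigma> (fsubst F l x) \<longleftrightarrow> sat I D (\<sigma>(x := lapp \<sigma> l)) F"
  shows "sat I D (\<sigma>(y := d)) (if y = x then F else fsubst F l x) \<longleftrightarrow>
    sat I D (\<sigma>(x := lapp \<sigma> l, y := d)) F"
proof (cases "x \<in> free F - {y}")
  case True
  with assms(1) have *: "y \<notin> lvars l" "CF F l x" "x \<noteq> y" by auto
  then have "lapp (\<sigma>(y := d)) l = lapp \<sigma> l" by (auto intro!: lapp_cong)
  with assms(2)[OF *(2)] *(3) show ?thesis by (simp add: fun_upd_twist)
next
  case False
  then have "sat I D (\<sigma>(y := d)) F \<longleftrightarrow> sat I D (\<sigma>(x := lapp \<sigma> l, y := d)) F"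
    by (intro sat_cong) auto
  with False show ?thesis by (auto simp: fsubst_idle)
qed

lemma sat_fsubst:
  "CF F l x \<Longrightarrow> sat I D \<sigma> (fsubst F l x) \<longleftrightarrow> sat I D (\<sigma>(x := lapp \<sigma> l)) F"
proof (induction F arbitrary: \<sigma>)
  case (All y F)
  have "x \<notin> free F - {y} \<or> y \<notin> lvars l \<and> CF F l x" using All.prems by simp
  from sat_fsubst_under_quantifier[OF this All.IH] show ?case by (simp only: fsubst.simps sat.simps)
next
  case (Ex y F)
  have "x \<notin> free F - {y} \<or> y \<notin> lvars l \<and> CF F l x" using Ex.prems by simp
  from sat_fsubst_under_quantifier[OF this Ex.IH] show ?case by (simp only: fsubst.simps sat.simps)
qed (simp_all add: lapp_lsubst comp_def)

lemma sat_foldr_Imp: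
  "sat I D \<sigma> (foldr Imp Hs F) \<longleftrightarrow> ((\<forall>H \<in> set Hs. sat I D \<sigma> H) \<longrightarrow> sat I D \<sigma> F)"
  by (induction Hs) auto

lemma sat_pinst: "sat I D \<sigma> (pinst \<phi> f) \<longleftrightarrow> peval (\<lambda>n. sat I D \<sigma> (\<phi> n)) f"
  by (induction f) auto

text \<open>The head pair is applied last: in the iterated substitution it is substituted first, so
  its update is the outermost one.\<close>

definition upds :: "(var \<Rightarrow> 'a lst) \<Rightarrow> var list \<Rightarrow> 'a lst list \<Rightarrow> var \<Rightarrow> 'a lst" where
  "upds \<sigma> xs ls = foldr (\<lambda>(x, l) \<tau>. \<tau>(x := l)) (zip xs ls) \<sigma>"

lemma upds_simps [simp]:
  "upds \<sigma> [] ls = \<sigma>"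
  "upds \<sigma> (x # xs) (l # ls) = (upds \<sigma> xs ls)(x := l)"
  by (simp_all add: upds_def)

lemma upds_idle: "x \<notin> set xs \<Longrightarrow> length ls = length xs \<Longrightarrow> upds \<sigma> xs ls x = \<sigma> x"
  by (induction xs ls rule: list_induct2') auto

lemma upds_self: "upds \<sigma> xs (map \<sigma> xs) = \<sigma>"
  by (induction xs) auto

lemma upds_rel:
  assumes "length ks = length xs" "length ls = length xs"
    and "\<And>x. R (\<sigma> x) (\<tau> x)" "\<forall>i < length xs. R (ks ! i) (ls ! i)"
  shows "R (upds \<sigma> xs ks x) (upds \<tau> xs ls x)"
  using assms(1,2,4)
proof (induction xs arbitrary: ks ls)
  case (Cons y xs)
  then obtain k ks' l ls' where [simp]: "ks = k # ks'" "ls = l # ls'"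
    by (metis length_Suc_conv length_Cons)
  have "R k l" using Cons.prems(3) by force
  moreover have "R (upds \<sigma> xs ks' x) (upds \<tau> xs ls' x)"
    by (rule Cons.IH) (use Cons.prems in auto)
  ultimately show ?case by simp
qed (simp add: assms)

lemma upds_in:
  assumes "length ls = length xs" "\<And>x. \<sigma> x \<in> D" "set ls \<subseteq> D"
  shows "upds \<sigma> xs ls x \<in> D"
  using assms(1,3) by (induction xs ls rule: list_induct2') (auto simp: assms(2))

text \<open>The arguments contain none of the \<open>xs\<close>, so later substitutions leave
  inserted arguments alone and the sequential substitution acts simultaneously. They contain no
  bound variable of \<open>G\<close> either, so no collision arises.\<close>

lemma sat_foldl_fsubst:
  assumes "length ls = length xs"
    and "\<And>l. l \<in> set ls \<Longrightarrow> lvars l \<inter> (set xs \<union> bvars G) = {}"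
  shows "sat I D \<sigma> (foldl (\<lambda>H (x, l). fsubst H l x) G (zip xs ls)) \<longleftrightarrow>
    sat I D (upds \<sigma> xs (map (lapp \<sigma>) ls)) G"
  using assms
proof (induction xs arbitrary: ls G)
  case (Cons x xs)
  then obtain l ls' where ls [simp]: "ls = l # ls'" by (metis length_Suc_conv length_Cons)
  let ?\<tau> = "upds \<sigma> xs (map (lapp \<sigma>) ls')"
  have "sat I D \<sigma> (foldl (\<lambda>H (x, l). fsubst H l x) (fsubst G l x) (zip xs ls')) \<longleftrightarrow>
      sat I D ?\<tau> (fsubst G l x)"
  proof (rule Cons.IH)
    fix l' assume "l' \<in> set ls'"
    then show "lvars l' \<inter> (set xs \<union> bvars (fsubst G l x)) = {}" using Cons.prems(2)[of l'] by auto
  qed (use Cons.prems(1) in simp)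
  also have "\<dots> \<longleftrightarrow> sat I D (?\<tau>(x := lapp ?\<tau> l)) G"
    using Cons.prems(2)[of l] by (intro sat_fsubst CF_if_bvars_disjoint) auto
  also have "lapp ?\<tau> l = lapp \<sigma> l"
    using Cons.prems by (intro lapp_cong upds_idle) auto
  finally show ?case by simp
qed simp

section \<open>R-derivable formulas\<close>

text \<open>Allows the two premises of a modus ponens to come from separate derivations. Every step
  of the appended derivation stays legal with more formulas in front.\<close>

lemma rderivation_append:
  "rderivation S L Gs \<Longrightarrow> rderivation S L Fs \<Longrightarrow> rderivation S L (Fs @ Gs)"
proof (induction rule: rderivation.induct)
  case (mp Gs F G)
  then show ?case using rderivation.mp[of S L "Fs @ Gs" F G] by simp
next
  case (subst Gs F l x)
  then show ?case using rderivation.subst[of S L "Fs @ Gs" F l x] by simp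
next
  case (basis Gs F)
  then show ?case using rderivation.basis[of S L "Fs @ Gs" F] by simp
next
  case (equality Gs F)
  then show ?case using rderivation.equality[of S L "Fs @ Gs" F] by simp
qed simp

lemma Pi_R_basis: "F \<in> B_S S \<Longrightarrow> formula (P_S S) L F \<Longrightarrow> F \<in> Pi_R S L"
  using rderivation.basis[OF rderivation.Nil] by (force simp: Pi_R_def)

lemma Pi_R_equality: "equality_axiom (P_S S) L F \<Longrightarrow> F \<in> Pi_R S L"
  using rderivation.equality[OF rderivation.Nil] by (force simp: Pi_R_def)

lemma Pi_R_subst:
  assumes "F \<in> Pi_R S L" "l \<in> L" shows "fsubst F l x \<in> Pi_R S L"
proof -
  obtain Fs where "rderivation S L Fs" "F \<in> set Fs" using assms(1) by (auto simp: Pi_R_def)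
  then have "rderivation S L (Fs @ [fsubst F l x])" using assms(2) by (rule rderivation.subst)
  then show ?thesis unfolding Pi_R_def by force
qed

lemma Pi_R_mp:
  assumes "prime_fml F" "F \<in> Pi_R S L" "Imp F G \<in> Pi_R S L" shows "G \<in> Pi_R S L"
proof -
  obtain Fs Gs where *: "rderivation S L Fs" "F \<in> set Fs" "rderivation S L Gs" "Imp F G \<in> set Gs"
    using assms(2,3) by (auto simp: Pi_R_def)
  then have "rderivation S L ((Fs @ Gs) @ [G])"
    using assms(1) by (intro rderivation.mp[of S L _ F] rderivation_append) auto
  then show ?thesis unfolding Pi_R_def by force
qed

section \<open>The shape of R-formulas\<close>

lemma is_rformula_simps [simp]:
  "is_rformula (Eq k l)"
  "is_rformula (Pred p ls)"
  "is_rformula (Imp F G) \<longleftrightarrow> prime_fml F \<and> is_rformula G"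
  by (auto intro: is_rformula.intros elim: is_rformula.cases)

lemma prime_fml_fsubst [simp]: "prime_fml (fsubst F l x) = prime_fml F"
  by (cases F) auto

lemma is_rformula_fsubst: "is_rformula F \<Longrightarrow> is_rformula (fsubst F l x)"
  by (induction rule: is_rformula.induct) (auto intro: is_rformula.intros)

lemma is_rformula_CF: "is_rformula F \<Longrightarrow> CF F l x"
proof (induction rule: is_rformula.induct)
  case (prime F)
  then show ?case by (cases F) auto
next
  case (imp F G)
  then show ?case by (cases F) auto
qed

lemma is_rformula_foldr_Imp:
  "\<forall>H \<in> set Hs. prime_fml H \<Longrightarrow> is_rformula F \<Longrightarrow> is_rformula (foldr Imp Hs F)"
  by (induction Hs) (auto intro: is_rformula.intros)

lemma is_rformula_equality: "equality_axiom P L F \<Longrightarrow> is_rformula F"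
proof (induction rule: equality_axiom.induct)
  case (pred p ys zs)
  show ?case
    by (rule is_rformula_foldr_Imp) auto
qed simp_all

lemma sat_closed_prime:
  assumes "prime_fml F" "free F = {}"
  shows "sat I D \<sigma> F \<longleftrightarrow> I F"
  using assms
proof (cases F)
  case (Pred p ls)
  with assms have "map (lapp \<sigma>) ls = ls" by (auto intro!: map_idI)
  with Pred show ?thesis by simp
qed auto

text \<open>Basis axioms must have their arguments in \<open>L\<close> to be written in
  R-derivations over \<open>L\<close>; \<open>recursive_system\<close> alone only makes them
  formulas over arbitrary lists.\<close>

locale restricted_lists =
  fixes S :: "('a, 'p) recsys" and L :: "'a lst set"
  assumes basis: "F \<in> B_S S \<Longrightarrow> is_rformula F \<and> formula (P_S S) L F"
    and Var_in: "[Var x] \<in> L"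
    and lsubst_in: "k \<in> L \<Longrightarrow> l \<in> L \<Longrightarrow> lsubst k l x \<in> L"
begin

abbreviation D :: "'a lst set" where "D \<equiv> elementary L"

abbreviation derivable :: "('a, 'p) fml \<Rightarrow> bool" where "derivable F \<equiv> F \<in> Pi_R S L"

abbreviation val :: "(var \<Rightarrow> 'a lst) \<Rightarrow> bool" where "val \<sigma> \<equiv> \<forall>x. \<sigma> x \<in> D"

abbreviation eqv :: "'a lst \<Rightarrow> 'a lst \<Rightarrow> bool" (infix \<open>\<approx>\<close> 50) where
  "k \<approx> l \<equiv> derivable (Eq k l)"

text \<open>\<open>L\<close> is closed under substitution for one variable at a time. Valuations
  have variable-free values, so substituting these successively for the finitely many variables of
  \<open>l\<close> gives the simultaneous substitution.\<close>

lemma lapp_in_D: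
  assumes "l \<in> L" "val \<sigma>"
  shows "lapp \<sigma> l \<in> D"
proof -
  have "lapp (\<lambda>x. if x \<in> A then \<sigma> x else [Var x]) l \<in> L" if "finite A" for A
    using that
  proof (induction A)
    case (insert x A)
    have "lapp (\<lambda>y. if y \<in> insert x A then \<sigma> y else [Var y]) l =
        lsubst (lapp (\<lambda>y. if y \<in> A then \<sigma> y else [Var y]) l) (\<sigma> x) x"
      unfolding lsubst_eq_lapp lapp_lapp
      using insert.hyps assms(2) by (intro lapp_cong) (auto simp: elementary_def)
    then show ?case using insert.IH assms(2) by (auto simp: elementary_def intro: lsubst_in)
  qed (simp add: assms)
  from this[of "lvars l"] have "lapp (\<lambda>x. if x \<in> lvars l then \<sigma> x else [Var x]) l \<in> L" by simp
  also have "lapp (\<lambda>x. if x \<in> lvars l then \<sigma> x else [Var x]) l = lapp \<sigma> l"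
    by (rule lapp_cong) simp
  finally show ?thesis using assms(2) by (auto simp: elementary_def lvars_lapp)
qed

text \<open>A closed prime premise that is satisfied is derivable, so R-modus ponens strips the
  premises one by one.\<close>

lemma derivable_closed_sat:
  "is_rformula F \<Longrightarrow> free F = {} \<Longrightarrow> derivable F \<Longrightarrow> sat derivable D \<sigma> F"
proof (induction rule: is_rformula.induct)
  case (prime F)
  then show ?case by (simp add: sat_closed_prime)
next
  case (imp F G)
  then show ?case using Pi_R_mp[of F S L G] by (auto simp: sat_closed_prime)
qed

text \<open>Substituting its elementary value for one free variable preserves derivability and
  lowers the number of free variables, down to the closed case.\<close>

lemma derivable_sat:
  assumes "is_rformula F" "derivable F" "val \<sigma>"
  shows "sat derivable D \<sigma> F"
  using assms(1,2)
proof (induction "card (free F)" arbitrary: F rule: less_induct)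
  case less
  show ?case
  proof (cases "free F = {}")
    case True
    with less.prems show ?thesis by (intro derivable_closed_sat)
  next
    case False
    then obtain x where x: "x \<in> free F" by auto
    from assms(3) have l: "\<sigma> x \<in> L" "lvars (\<sigma> x) = {}" by (auto simp: elementary_def)
    have "card (free (fsubst F (\<sigma> x) x)) < card (free F)"
      using x l by (simp add: free_fsubst_closed card_Diff1_less del: card_Diff_insert)
    then have "sat derivable D \<sigma> (fsubst F (\<sigma> x) x)"
      using less.prems l by (intro less.hyps is_rformula_fsubst Pi_R_subst)
    then show ?thesis using l by (simp add: sat_fsubst CF_closed)
  qed
qed

section \<open>Derivable equality as a congruence on elementary lists\<close>

lemma sat_equality:
  "equality_axiom (P_S S) L F \<Longrightarrow> val \<sigma> \<Longrightarrow> sat derivable D \<sigma> F"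
  by (intro derivable_sat is_rformula_equality Pi_R_equality)

lemma eqv_refl: "d \<in> D \<Longrightarrow> d \<approx> d"
  using sat_equality[OF equality_axiom.refl, of "\<lambda>_. d" 0] by simp

text \<open>Semantic form of substitutivity in equations. The axiom replaces \<open>x\<close> by
  another variable, so a fresh \<open>y\<close> is chosen to carry the new value
  \<open>d\<close>.\<close>

lemma eqv_upd:
  assumes "k \<in> L" "l \<in> L" "val \<tau>" "d \<in> D" "\<tau> x \<approx> d" "lapp \<tau> k \<approx> lapp \<tau> l"
  shows "lapp (\<tau>(x := d)) k \<approx> lapp (\<tau>(x := d)) l"
proof -
  have "finite (insert x (lvars k \<union> lvars l))" by simp
  then obtain y where y: "y \<notin> insert x (lvars k \<union> lvars l)"
    using ex_new_if_finite[OF infinite_UNIV_nat] by blast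
  let ?\<tau> = "\<tau>(y := d)"
  have "val ?\<tau>" using assms by simp
  from sat_equality[OF equality_axiom.eq[OF assms(1,2), of _ x y] this]
  have "?\<tau> x \<approx> ?\<tau> y \<Longrightarrow> lapp ?\<tau> k \<approx> lapp ?\<tau> l \<Longrightarrow>
      lapp (?\<tau>(x := d)) k \<approx> lapp (?\<tau>(x := d)) l"
    by (simp add: lapp_lsubst fun_upd_same del: fun_upd_apply)
  moreover have "lapp ?\<tau> k = lapp \<tau> k" "lapp ?\<tau> l = lapp \<tau> l"
    "lapp (?\<tau>(x := d)) k = lapp (\<tau>(x := d)) k" "lapp (?\<tau>(x := d)) l = lapp (\<tau>(x := d)) l"
    using y by (auto intro!: lapp_cong)
  ultimately show ?thesis using assms(5,6) y by simp
qed

lemma eqv_sym: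
  assumes "a \<in> D" "b \<in> D" "a \<approx> b" shows "b \<approx> a"
proof -
  \<comment> \<open>Only variable 0 moves from \<open>a\<close> to \<open>b\<close>; this turns
    \<open>a \<approx> a\<close> into \<open>b \<approx> a\<close>.\<close>
  let ?\<tau> = "\<lambda>_::var. a"
  have "lapp ?\<tau> [Var 0] \<approx> lapp ?\<tau> [Var 1]" using eqv_refl[OF assms(1)] by simp
  from eqv_upd[OF Var_in Var_in _ assms(2) _ this, of 0] assms
  have "lapp (?\<tau>(0 := b)) [Var 0] \<approx> lapp (?\<tau>(0 := b)) [Var 1]" by blast
  then show ?thesis by simp
qed

lemma eqv_trans:
  assumes "a \<in> D" "b \<in> D" "c \<in> D" "a \<approx> b" "b \<approx> c" shows "a \<approx> c"
proof -
  \<comment> \<open>Moving variable 1 from \<open>b\<close> to \<open>c\<close> turns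
    \<open>a \<approx> b\<close> into \<open>a \<approx> c\<close>.\<close>
  let ?\<tau> = "\<lambda>x::var. if x = 0 then a else b"
  have "lapp ?\<tau> [Var 0] \<approx> lapp ?\<tau> [Var 1]" using assms by simp
  moreover have "val ?\<tau>" using assms by simp
  moreover have "?\<tau> 1 \<approx> c" using assms by simp
  ultimately have "lapp (?\<tau>(1 := c)) [Var 0] \<approx> lapp (?\<tau>(1 := c)) [Var 1]"
    by (rule eqv_upd[OF Var_in Var_in _ assms(3), rotated 2])
  then show ?thesis by simp
qed

text \<open>\<open>eqv_upd\<close> changes both sides of an equation. To hold one side fixed,
  \<open>x\<close> is renamed there to a fresh \<open>z\<close> that keeps the old value; the
  equation then comes out reversed.\<close>

lemma lapp_eqv_upd:
  assumes "k \<in> L" "val \<sigma>" "d \<in> D" "\<sigma> x \<approx> d"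
  shows "lapp \<sigma> k \<approx> lapp (\<sigma>(x := d)) k"
proof -
  have "finite (insert x (lvars k))" by simp
  then obtain z where z: "z \<notin> insert x (lvars k)"
    using ex_new_if_finite[OF infinite_UNIV_nat] by blast
  let ?\<tau> = "\<sigma>(z := \<sigma> x)"
  let ?l = "lsubst k [Var z] x"
  have 1: "lapp ?\<tau> k = lapp \<sigma> k"
    using z by (auto intro!: lapp_cong)
  have 2: "lapp ?\<tau> ?l = lapp \<sigma> k" "lapp (?\<tau>(x := d)) ?l = lapp \<sigma> k"
    unfolding lapp_lsubst using z by (auto intro!: lapp_cong)
  have 3: "lapp (?\<tau>(x := d)) k = lapp (\<sigma>(x := d)) k"
    using z by (auto intro!: lapp_cong)
  have "lapp \<sigma> k \<approx> lapp \<sigma> k" using assms by (intro eqv_refl lapp_in_D)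
  moreover have "?l \<in> L" using assms(1) by (intro lsubst_in Var_in)
  moreover have "val ?\<tau>" using assms(2) by simp
  moreover have "?\<tau> x \<approx> d" using assms(4) z by simp
  ultimately have "lapp (\<sigma>(x := d)) k \<approx> lapp \<sigma> k"
    using eqv_upd[of k ?l ?\<tau> d x] assms(1,3) unfolding 1 2 3 by blast
  then show ?thesis by (rule eqv_sym[rotated 2]) (use assms in \<open>auto intro: lapp_in_D\<close>)
qed

text \<open>The valuations are exchanged one variable at a time; the finitely many variables of
  \<open>k\<close> suffice.\<close>

lemma lapp_eqv:
  assumes "k \<in> L" "val \<sigma>" "val \<tau>" "\<forall>x. \<sigma> x \<approx> \<tau> x"
  shows "lapp \<sigma> k \<approx> lapp \<tau> k"
proof -
  have "lapp \<sigma> k \<approx> lapp (\<lambda>x. if x \<in> A then \<tau> x else \<sigma> x) k" if "finite A" for A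
    using that
  proof (induction A)
    case empty
    then show ?case using assms by (simp add: eqv_refl lapp_in_D)
  next
    case (insert x A)
    let ?\<rho> = "\<lambda>x. if x \<in> A then \<tau> x else \<sigma> x"
    have eq: "(\<lambda>y. if y \<in> insert x A then \<tau> y else \<sigma> y) = ?\<rho>(x := \<tau> x)" by auto
    have "lapp ?\<rho> k \<approx> lapp (?\<rho>(x := \<tau> x)) k"
      using assms insert.hyps by (intro lapp_eqv_upd) auto
    with insert.IH show ?case
      unfolding eq by (rule eqv_trans[rotated 3]) (use assms in \<open>auto intro: lapp_in_D\<close>)
  qed
  from this[of "lvars k"]
  have "lapp \<sigma> k \<approx> lapp (\<lambda>x. if x \<in> lvars k then \<tau> x else \<sigma> x) k" by simp
  also have "lapp (\<lambda>x. if x \<in> lvars k then \<tau> x else \<sigma> x) k = lapp \<tau> k"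
    by (rule lapp_cong) simp
  finally show ?thesis .
qed

lemma derivable_Pred_eqv:
  assumes "p \<in> P_S S" "length ks = length ls" "set ks \<subseteq> D" "set ls \<subseteq> D"
    and "\<forall>i < length ks. ks ! i \<approx> ls ! i" "derivable (Pred p ks)"
  shows "derivable (Pred p ls)"
proof (cases "ks = []")
  case True
  with assms show ?thesis by simp
next
  case False
  let ?n = "length ks"
  let ?ys = "[0..<?n]" and ?zs = "[?n..<?n + ?n]"
  \<comment> \<open>The axiom speaks of variables: the first \<open>?n\<close> indices carry
    \<open>ks\<close>, the next \<open>?n\<close> carry \<open>ls\<close>. The default
    \<open>ks ! 0\<close> keeps all values elementary, which is why the empty tuple is treated
    apart.\<close>
  define \<tau> where
    "\<tau> i = (if i < ?n then ks ! i else if i < ?n + ?n then ls ! (i - ?n) else ks ! 0)" for i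
  have "ks ! i \<in> D" "ls ! i \<in> D" if "i < ?n" for i using assms that by auto
  moreover have "0 < ?n" using False by simp
  ultimately have "val \<tau>" by (simp add: \<tau>_def)
  from sat_equality[OF equality_axiom.pred[OF assms(1), of ?ys ?zs] this]
  have "(\<forall>i < ?n. \<tau> i \<approx> \<tau> (?n + i)) \<longrightarrow> derivable (Pred p (map \<tau> ?ys)) \<longrightarrow>
      derivable (Pred p (map \<tau> ?zs))"
    by (auto simp: sat_foldr_Imp comp_def set_zip)
  moreover have "map \<tau> ?ys = ks" "map \<tau> ?zs = ls"
    using assms(2) by (auto intro!: nth_equalityI simp: \<tau>_def)
  ultimately show ?thesis using assms(5,6) by (simp add: \<tau>_def)
qed

text \<open>Prime formulas are settled by the congruence properties; under a quantifier both
  valuations receive the same value, equal to itself by reflexivity. This makes the relation defined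
  by \<open>G\<close> compatible with equality.\<close>

lemma sat_eqv:
  assumes "formula (P_S S) L G" "val \<sigma>" "val \<tau>" "\<forall>x. \<sigma> x \<approx> \<tau> x"
  shows "sat derivable D \<sigma> G \<longleftrightarrow> sat derivable D \<tau> G"
  using assms
proof (induction G arbitrary: \<sigma> \<tau>)
  case (Eq k l)
  then have "lapp \<sigma> k \<approx> lapp \<tau> k" "lapp \<sigma> l \<approx> lapp \<tau> l" by (auto intro: lapp_eqv)
  moreover have "lapp \<sigma> k \<in> D" "lapp \<sigma> l \<in> D" "lapp \<tau> k \<in> D" "lapp \<tau> l \<in> D"
    using Eq by (auto intro: lapp_in_D)
  ultimately show ?case by (simp, blast intro: eqv_sym eqv_trans)
next
  case (Pred p ls)
  have *: "derivable (Pred p (map (lapp \<tau>) ls))"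
    if "derivable (Pred p (map (lapp \<sigma>) ls))" "val \<sigma>" "val \<tau>" "\<forall>x. \<sigma> x \<approx> \<tau> x" for \<sigma> \<tau>
    using that Pred.prems(1)
    by (intro derivable_Pred_eqv[of p "map (lapp \<sigma>) ls" "map (lapp \<tau>) ls"])
       (auto intro!: lapp_in_D lapp_eqv)
  have "\<forall>x. \<tau> x \<approx> \<sigma> x" using Pred.prems eqv_sym by blast
  with *[of \<sigma> \<tau>] *[of \<tau> \<sigma>] Pred.prems show ?case by auto
next
  case (Neg F)
  from Neg.IH[of \<sigma> \<tau>] Neg.prems show ?case by simp
next
  case (Imp F G)
  from Imp.IH[of \<sigma> \<tau>] Imp.prems show ?case by simp
next
  case (Iff F G)
  from Iff.IH[of \<sigma> \<tau>] Iff.prems show ?case by simp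
next
  case (Conj F G)
  from Conj.IH[of \<sigma> \<tau>] Conj.prems show ?case by simp
next
  case (Disj F G)
  from Disj.IH[of \<sigma> \<tau>] Disj.prems show ?case by simp
next
  case (All x F)
  have "sat derivable D (\<sigma>(x := d)) F = sat derivable D (\<tau>(x := d)) F" if "d \<in> D" for d
    by (rule All.IH) (use All.prems that eqv_refl in auto)
  then show ?case by simp
next
  case (Ex x F)
  have "sat derivable D (\<sigma>(x := d)) F = sat derivable D (\<tau>(x := d)) F" if "d \<in> D" for d
    by (rule Ex.IH) (use Ex.prems that eqv_refl in auto)
  then show ?case by simp
qed

section \<open>Soundness\<close>

context
  fixes p :: 'p and xs :: "var list" and G :: "('a, 'p) fml" and \<rho> :: "var \<Rightarrow> 'a lst"
  assumes G: "formula (P_S S) L G"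
    and fresh: "F \<in> B_S S \<Longrightarrow> (set xs \<union> vars G) \<inter> vars F = {}"
    and hyp: "F \<in> B_S S \<Longrightarrow> rconclusion F = Pred p ls \<Longrightarrow> length ls = length xs \<Longrightarrow>
      val \<sigma> \<Longrightarrow> sat derivable D \<sigma> (ind_replace p xs G F)"
    and \<rho>: "val \<rho>"
begin

text \<open>The variables of \<open>G\<close> outside \<open>xs\<close> act as parameters with
  values fixed by \<open>\<rho>\<close>. Equations, other predicates and other arities of
  \<open>p\<close> keep their meaning.\<close>

definition ind_holds :: "('a, 'p) fml \<Rightarrow> bool" where
  "ind_holds F \<longleftrightarrow> derivable F \<and>
     (\<forall>ls. F = Pred p ls \<longrightarrow> length ls = length xs \<longrightarrow> sat derivable D (upds \<rho> xs ls) G)"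

lemma ind_holds_Eq [simp]: "ind_holds (Eq k l) \<longleftrightarrow> k \<approx> l"
  by (simp add: ind_holds_def)

lemma ind_holds_Pred: "ind_holds (Pred q ls) \<longleftrightarrow> derivable (Pred q ls) \<and>
    (q = p \<and> length ls = length xs \<longrightarrow> sat derivable D (upds \<rho> xs ls) G)"
  by (auto simp: ind_holds_def)

text \<open>Two valuations are needed: \<open>\<sigma>\<close> evaluates the axiom, while the
  parameters of \<open>G\<close> must keep their values under \<open>\<rho>\<close>. The mixture
  \<open>\<tau>\<close> does both because the variables in \<open>A\<close> are disjoint from
  \<open>xs\<close> and from those of \<open>G\<close>; the same disjointness permits the iterated
  substitution.\<close>

lemma sat_ind_holds_prime:
  assumes "prime_fml F" "vars F \<subseteq> A" "(set xs \<union> vars G) \<inter> A = {}"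
    and "\<And>x. x \<in> A \<Longrightarrow> \<tau> x = \<sigma> x" "\<And>x. x \<notin> A \<Longrightarrow> \<tau> x = \<rho> x"
  shows "sat ind_holds D \<sigma> F \<longleftrightarrow>
    sat derivable D \<sigma> F \<and> sat derivable D \<tau> (ind_replace p xs G F)"
proof -
  have \<tau>: "sat derivable D \<tau> F \<longleftrightarrow> sat derivable D \<sigma> F"
    using assms(2,4) free_subset_vars[of F] by (intro sat_cong) auto
  show ?thesis
  proof (cases F)
    case (Pred q ls)
    show ?thesis
    proof (cases "q = p \<and> length ls = length xs")
      case True
      have "sat derivable D \<tau> (ind_replace p xs G F) \<longleftrightarrow>
          sat derivable D (upds \<tau> xs (map (lapp \<tau>) ls)) G"
        using True Pred assms(2,3) bvars_subset_vars[of G] by (auto intro!: sat_foldl_fsubst)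
      also have "map (lapp \<tau>) ls = map (lapp \<sigma>) ls"
        using Pred assms(2,4) by (auto intro!: lapp_cong)
      also have "sat derivable D (upds \<tau> xs (map (lapp \<sigma>) ls)) G \<longleftrightarrow>
          sat derivable D (upds \<rho> xs (map (lapp \<sigma>) ls)) G"
      proof (rule sat_cong)
        fix x assume "x \<in> free G"
        then have "x \<notin> A" using assms(3) free_subset_vars[of G] by auto
        then have "\<tau> x = \<rho> x" by (rule assms(5))
        then show "upds \<tau> xs (map (lapp \<sigma>) ls) x = upds \<rho> xs (map (lapp \<sigma>) ls) x"
          using True by (induction xs ls rule: list_induct2') auto
      qed
      finally show ?thesis using True Pred by (simp add: ind_holds_Pred)
    next
      case False
      then show ?thesis using Pred \<tau> by (auto simp: ind_holds_Pred)
    qed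
  qed (use \<tau> assms(1) in auto)
qed

text \<open>A premise true in the new reading satisfies both its original and its replaced form, so
  it can be discharged from the axiom and from its replaced version at once, leaving both forms of
  the conclusion.\<close>

lemma sat_ind_holds_rformula:
  assumes "is_rformula F" "vars F \<subseteq> A" "(set xs \<union> vars G) \<inter> A = {}"
    and "\<And>x. x \<in> A \<Longrightarrow> \<tau> x = \<sigma> x" "\<And>x. x \<notin> A \<Longrightarrow> \<tau> x = \<rho> x"
    and "sat derivable D \<sigma> F"
    and "\<And>ls. rconclusion F = Pred p ls \<Longrightarrow> length ls = length xs \<Longrightarrow>
      sat derivable D \<tau> (ind_replace p xs G F)"
  shows "sat ind_holds D \<sigma> F"
  using assms(1,2,6,7)
proof (induction rule: is_rformula.induct)
  case (prime F)
  have \<tau>: "sat derivable D \<tau> F"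
    using prime assms(4) free_subset_vars[of F] by (subst sat_cong[of F \<tau> \<sigma>]) auto
  have "sat derivable D \<tau> (ind_replace p xs G F)"
  proof (cases "\<exists>ls. F = Pred p ls \<and> length ls = length xs")
    case True
    then show ?thesis using prime.prems(3) by auto
  next
    \<comment> \<open>The rule supplies the replaced axiom only for \<open>i\<close>-ary conclusions
      in \<open>p\<close>; any other prime conclusion is unchanged by the replacement.\<close>
    case False
    then have "ind_replace p xs G F = F" using prime.hyps by (cases F) auto
    then show ?thesis using \<tau> by simp
  qed
  then show ?case using sat_ind_holds_prime[OF prime.hyps prime.prems(1) assms(3-5)] prime.prems(2)
    by simp
next
  case (imp F H)
  show ?case
  proof (simp, intro impI)
    assume "sat ind_holds D \<sigma> F"
    then have *: "sat derivable D \<sigma> F" "sat derivable D \<tau> (ind_replace p xs G F)"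
      using sat_ind_holds_prime[OF imp.hyps(1) _ assms(3-5)] imp.prems(1) by auto
    show "sat ind_holds D \<sigma> H"
      by (rule imp.IH) (use imp.prems * in auto)
  qed
qed

lemma sat_ind_holds_basis:
  assumes "F \<in> B_S S" "val \<sigma>"
  shows "sat ind_holds D \<sigma> F"
proof (rule sat_ind_holds_rformula)
  let ?\<tau> = "\<lambda>x. if x \<in> vars F then \<sigma> x else \<rho> x"
  show "?\<tau> x = \<sigma> x" if "x \<in> vars F" for x using that by simp
  show "?\<tau> x = \<rho> x" if "x \<notin> vars F" for x using that by simp
  show "sat derivable D \<sigma> F" using assms basis by (intro derivable_sat Pi_R_basis) auto
  show "sat derivable D ?\<tau> (ind_replace p xs G F)"
    if "rconclusion F = Pred p ls" "length ls = length xs" for ls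
    using assms that \<rho> by (intro hyp) auto
qed (use assms basis fresh in auto)

lemma sat_ind_holds_equality:
  assumes "equality_axiom (P_S S) L F" "val \<sigma>"
  shows "sat ind_holds D \<sigma> F"
  using assms(1)
proof cases
  case (refl x)
  then show ?thesis using sat_equality[OF assms] by simp
next
  case (eq k l x y)
  then show ?thesis using sat_equality[OF assms] by simp
next
  case (pred q ys zs)
  have "ind_holds (Pred q (map \<sigma> zs))"
    if 1: "\<forall>i < length ys. \<sigma> (ys ! i) \<approx> \<sigma> (zs ! i)" and 2: "ind_holds (Pred q (map \<sigma> ys))"
  proof -
    have "derivable (Pred q (map \<sigma> zs))"
      using derivable_Pred_eqv[of q "map \<sigma> ys" "map \<sigma> zs"] 1 2 pred assms(2)
      by (auto simp: ind_holds_Pred)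
    moreover have "sat derivable D (upds \<rho> xs (map \<sigma> zs)) G"
      if "q = p" "length zs = length xs"
    proof -
      have "sat derivable D (upds \<rho> xs (map \<sigma> ys)) G"
        using 2 that pred by (simp add: ind_holds_Pred)
      \<comment> \<open>Equal argument tuples give pointwise equal valuations, so
        \<open>sat_eqv\<close> carries \<open>G\<close> from \<open>ys\<close> to
        \<open>zs\<close>.\<close>
      moreover have "\<forall>x. upds \<rho> xs (map \<sigma> ys) x \<approx> upds \<rho> xs (map \<sigma> zs) x"
        using that pred 1 \<rho> by (auto intro!: upds_rel[where R = "(\<approx>)"] eqv_refl)
      moreover have "val (upds \<rho> xs (map \<sigma> ys))" "val (upds \<rho> xs (map \<sigma> zs))"
        using that pred \<rho> assms(2) by (auto intro!: upds_in)
      ultimately show ?thesis using sat_eqv[OF G] by blast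
    qed
    ultimately show ?thesis by (simp add: ind_holds_Pred)
  qed
  then show ?thesis using pred by (auto simp: sat_foldr_Imp comp_def set_zip)
qed

text \<open>Being an R-formula is carried along because it guarantees collision-free
  substitution.\<close>

lemma sat_ind_holds_derivation:
  assumes "rderivation S L Fs"
  shows "F \<in> set Fs \<Longrightarrow> is_rformula F \<and> (\<forall>\<sigma>. val \<sigma> \<longrightarrow> sat ind_holds D \<sigma> F)"
  using assms
proof (induction arbitrary: F rule: rderivation.induct)
  case (basis Fs H)
  then show ?case using restricted_lists_axioms sat_ind_holds_basis
    by (auto simp: restricted_lists_def)
next
  case (equality Fs H)
  then show ?case using is_rformula_equality sat_ind_holds_equality by auto
next
  case (mp Fs H K)
  from mp.IH[OF mp.hyps(3)] mp.IH[OF mp.hyps(4)] mp.IH[of F] mp.prems show ?case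
    by auto
next
  case (subst Fs H l x)
  have "is_rformula (fsubst H l x)" "\<forall>\<sigma>. val \<sigma> \<longrightarrow> sat ind_holds D \<sigma> (fsubst H l x)"
    using subst.IH[OF subst.hyps(2)] subst.hyps(3)
    by (auto simp: sat_fsubst is_rformula_CF is_rformula_fsubst lapp_in_D)
  then show ?case using subst.IH[of F] subst.prems by auto
qed simp

text \<open>The derivable atom at the values of \<open>xs\<close> holds in the new reading, which
  yields \<open>G\<close> under \<open>upds \<rho> xs (map \<rho> xs)\<close>, that is, under
  \<open>\<rho>\<close>.\<close>

lemma sat_ind_conclusion: "sat derivable D \<rho> (Imp (Pred p (map (\<lambda>x. [Var x]) xs)) G)"
proof (simp add: comp_def, rule impI)
  assume "derivable (Pred p (map \<rho> xs))"
  then have "sat ind_holds D \<rho> (Pred p (map \<rho> xs))"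
    using sat_ind_holds_derivation \<rho> unfolding Pi_R_def by blast
  moreover have "map (lapp \<rho>) (map \<rho> xs) = map \<rho> xs"
    using \<rho> by (auto simp: elementary_def)
  ultimately have "ind_holds (Pred p (map \<rho> xs))" by (simp only: sat.simps)
  then show "sat derivable D \<rho> G" by (simp add: ind_holds_Pred upds_self)
qed

end

section \<open>Soundness of the whole calculus\<close>

lemma sat_quantifier:
  assumes "quantifier_axiom F" "val \<sigma>"
  shows "sat derivable D \<sigma> F"
  using assms(1)
proof cases
  case (1 x F)
  have "sat derivable D (\<sigma>(x := \<sigma> x)) F" if "\<forall>d \<in> D. sat derivable D (\<sigma>(x := d)) F"
    using that assms(2) by blast
  with 1 show ?thesis by simp
qed (auto simp: sat_upd_idle)

text \<open>The valuation stays arbitrary in the induction on proofs: substitution and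
  generalization change it, and the premises of the induction rule are used under all
  valuations.\<close>

lemma sound:
  assumes "rec_of M = S" "P_M M = P_S S" "B_M M = B_S S" "is_proof M L Fs"
  shows "F \<in> set Fs \<Longrightarrow> val \<sigma> \<Longrightarrow> sat derivable D \<sigma> F"
  using assms(4)
proof (induction arbitrary: F \<sigma> rule: is_proof.induct)
  case (axiom Fs H)
  have "sat derivable D \<sigma> H" using axiom.hyps(2)
  proof cases
    case basis
    then show ?thesis
      using assms axiom.prems restricted_lists.basis[OF restricted_lists_axioms]
      by (intro derivable_sat Pi_R_basis) auto
  next
    case (propositional f \<phi>)
    then show ?thesis by (simp add: sat_pinst)
  next
    case equality
    with assms(2) have "equality_axiom (P_S S) L H" by simp
    then show ?thesis using axiom.prems(2) by (rule sat_equality)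
  next
    case quantifier
    then show ?thesis using axiom.prems by (auto intro: sat_quantifier)
  qed
  then show ?case using axiom.IH[OF _ axiom.prems(2)] axiom.prems(1) by auto
next
  case (mp Fs H K)
  have "sat derivable D \<sigma> K"
    using mp.IH[OF mp.hyps(2) mp.prems(2)] mp.IH[OF mp.hyps(3) mp.prems(2)] by simp
  then show ?case using mp.IH[OF _ mp.prems(2)] mp.prems(1) by auto
next
  case (subst Fs H l x)
  have "val (\<sigma>(x := lapp \<sigma> l))" using lapp_in_D[OF subst.hyps(3) subst.prems(2)] subst.prems(2) by simp
  from subst.IH[OF subst.hyps(2) this] have "sat derivable D \<sigma> (fsubst H l x)"
    by (simp only: sat_fsubst[OF subst.hyps(4)])
  then show ?case using subst.IH[OF _ subst.prems(2)] subst.prems(1) by auto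
next
  case (generalize Fs H x)
  have "sat derivable D (\<sigma>(x := d)) H" if "d \<in> D" for d
    by (rule generalize.IH[OF generalize.hyps(2)]) (use that generalize.prems(2) in simp)
  then have "sat derivable D \<sigma> (All x H)" by simp
  then show ?case using generalize.IH[OF _ generalize.prems(2)] generalize.prems(1) by auto
next
  case (induction Fs p xs G)
  have "sat derivable D \<sigma> (Imp (Pred p (map (\<lambda>x. [Var x]) xs)) G)"
  proof (rule sat_ind_conclusion)
    show "formula (P_S S) L G" using induction.hyps(4) assms(2) by simp
    show "(set xs \<union> vars G) \<inter> vars H = {}" if "H \<in> B_S S" for H
      using induction.hyps(5) that assms(1) by blast
    show "sat derivable D \<tau> (ind_replace p xs G H)"
      if "H \<in> B_S S" "rconclusion H = Pred p ls" "length ls = length xs" "val \<tau>" for H ls \<tau>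
      using that assms(1) by (intro induction.IH induction.hyps(6)[of H ls]) simp_all
    show "val \<sigma>" by fact
  qed
  then show ?case using induction.IH[OF _ induction.prems(2)] induction.prems(1) by auto
next
  case Nil
  from Nil.prems(1) show ?case by (simp only: set_simps empty_iff)
qed

text \<open>\<open>V\<close> substitutes elementary lists where \<open>sat\<close> updates the
  valuation; \<open>sat_fsubst\<close> links the two, as closed lists cannot collide. An instance of
  a quantified body need not be a subformula, hence the induction on \<open>depth\<close>.\<close>

lemma V_iff_sat:
  assumes "basic_fml F" "free F = {}"
  shows "Top \<in> V S L F \<longleftrightarrow> sat derivable D \<sigma> F"
  using assms
proof (induction "depth F" arbitrary: F \<sigma> rule: less_induct)
  case less
  show ?case
  proof (cases F)
    case (Pred p ls)
    with less.prems show ?thesis using sat_closed_prime[of F derivable D \<sigma>] by simp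
  next
    case (Neg G)
    with less.hyps[of G \<sigma>] less.prems show ?thesis by simp
  next
    case (Imp G H)
    with less.hyps[of G \<sigma>] less.hyps[of H \<sigma>] less.prems show ?thesis by simp
  next
    case (All x G)
    have "Top \<in> V S L (fsubst G d x) \<longleftrightarrow> sat derivable D (\<sigma>(x := d)) G" if "d \<in> D" for d
    proof -
      have d: "lvars d = {}" using that by (simp add: elementary_def)
      have "basic_fml (fsubst G d x)" using less.prems All by (simp add: basic_fml_fsubst)
      then have "Top \<in> V S L (fsubst G d x) \<longleftrightarrow> sat derivable D \<sigma> (fsubst G d x)"
        using less.prems All d by (intro less.hyps) (auto simp: free_fsubst_closed)
      then show ?thesis using d by (simp add: sat_fsubst CF_closed)
    qed
    with All show ?thesis by simp
  qed (use less.prems in auto)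
qed

end

section \<open>Universal closure and the final result\<close>

lemma free_Gen: "free (Gen F) = {}"
proof -
  have "free (foldr All xs F) = free F - set xs" for xs by (induction xs) auto
  then show ?thesis by (simp add: Gen_def)
qed

lemma basic_fml_Gen: "basic_fml (Gen F) = basic_fml F"
proof -
  have "basic_fml (foldr All xs F) = basic_fml F" for xs by (induction xs) auto
  then show ?thesis by (simp add: Gen_def)
qed

lemma sat_Gen:
  assumes "\<And>\<sigma>. \<forall>x. \<sigma> x \<in> D \<Longrightarrow> sat I D \<sigma> F" "\<forall>x. \<sigma> x \<in> D"
  shows "sat I D \<sigma> (Gen F)"
proof -
  have "sat I D \<sigma> (foldr All xs F)" for xs using assms(2)
    by (induction xs arbitrary: \<sigma>) (auto intro: assms(1))
  then show ?thesis by (simp add: Gen_def)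
qed

theorem theorem3p5:
  fixes M :: "('a, 'p) mathsys" and L :: "'a lst set" and F :: "('a, 'p) fml"
  assumes "restricted_system M L"
    and "A_M M = A_S (rec_of M)"
    and "P_M M = P_S (rec_of M)"
    and "B_M M = B_S (rec_of M)"
    and "countable L"
    and "elementary L \<noteq> {}"
    and "formula (P_M M) L F"
    and "basic_fml F"
    and "provable M L F"
  shows "Top \<in> V (rec_of M) L (Gen F)"
proof -
  interpret restricted_lists "rec_of M" L
    using assms(1,3,4)
    by unfold_locales (auto simp: restricted_system_def recursive_system_def)
  \<comment> \<open>Nonemptiness of \<open>elementary L\<close> provides a valuation, the constant
    one.\<close>
  obtain d where d: "d \<in> D" using assms(6) by auto
  have "sat derivable D (\<lambda>_. d) (Gen F)"
    using assms(3,4,9) sound[of M] d by (intro sat_Gen) (auto simp: provable_def)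
  then show ?thesis using V_iff_sat[of "Gen F"] assms(8) by (simp add: free_Gen basic_fml_Gen)
qed

end
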